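(* Let $K$ be a loopfree category and let $G$ be a group acting on $K$. The following two assertions are equivalent: (1) Condition (SR): if $x,y\in\mathcal M(K)$ satisfy $\partial^\bullet x=\partial^\bullet y$ and $G\partial_\bullet x=G\partial_\bullet y$, then $Gx=Gy$. (2) $G$ acts regularly on $K$ and $K/G$ is a poset.
   Context: $\mathcal M(K)$ is the set of morphisms of a small category $K$, and $\mathcal M_K(x,y)$ the set of morphisms from $x$ to $y$. A morphism $m$ from $a$ to $b$ has $\partial^\bullet m=a$ (source) and $\partial_\bullet m=b$ (target). Composition is in diagrammatic order: $x\circ y$ is defined when $\partial_\bullet x=\partial^\bullet y$. $K$ is loopfree if for all objects $x\ne y$ at most one of $\mathcal M_K(x,y)$, $\mathcal M_K(y,x)$ is nonempty, and $\mathcal M_K(x,x)=\{\mathrm{id}_x\}$ for all $x$. A group $G$ (viewed as a one-object category) acts on $K$ if there is a functor $\mathcal A_K:G\to\mathbf{Cat}$ ($\mathbf{Cat}$ = category of small categories) sending the unique object to $K$; thus each $g\in G$ acts as an automorphism of $K$. $Gx$ denotes the orbit of an object or morphism $x$. The quotient $K/G$ is the colimit of $\mathcal A_K$ in $\mathbf{Cat}$. A category is a poset if there is at most one morphism from any object to any other and no two distinct objects have morphisms in both directions between them. $G$ acts regularly on $K$ if Condition (R) holds: whenever $x,y_a,y_b\in\mathcal M(K)$ satisfy $\partial_\bullet x=\partial^\bullet y_a=\partial^\bullet y_b$ and $Gy_a=Gy_b$, then $G(x\circ y_a)=G(x\circ y_b)$. *)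

theory Defs
  imports "HOL-Algebra.Group_Action"
begin

section \<open>Small categories and functors\<close>

text \<open>
  A small category has a set of objects and a set of morphisms; the structure maps are total
  functions whose values outside these sets carry no information. Composition is written in
  diagrammatic order: \<open>x \<cdot> y\<close> is first \<open>x\<close>, then \<open>y\<close>.
\<close>

record ('o, 'm) category =
  Obj :: "'o set"
  Arr :: "'m set"
  Dom :: "'m \<Rightarrow> 'o"
  Cod :: "'m \<Rightarrow> 'o"
  Idt :: "'o \<Rightarrow> 'm"
  Cmp :: "'m \<Rightarrow> 'm \<Rightarrow> 'm"  (infixl \<open>\<cdot>\<index>\<close> 70)

definition is_category :: "('o, 'm) category \<Rightarrow> bool" where
  "is_category K \<longleftrightarrow>
     (\<forall>m\<in>Arr K. Dom K m \<in> Obj K \<and> Cod K m \<in> Obj K) \<and>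
     (\<forall>x\<in>Obj K. Idt K x \<in> Arr K \<and> Dom K (Idt K x) = x \<and> Cod K (Idt K x) = x) \<and>
     (\<forall>m\<in>Arr K. \<forall>n\<in>Arr K. Cod K m = Dom K n \<longrightarrow>
        m \<cdot>\<^bsub>K\<^esub> n \<in> Arr K \<and> Dom K (m \<cdot>\<^bsub>K\<^esub> n) = Dom K m \<and> Cod K (m \<cdot>\<^bsub>K\<^esub> n) = Cod K n) \<and>
     (\<forall>m\<in>Arr K. Idt K (Dom K m) \<cdot>\<^bsub>K\<^esub> m = m \<and> m \<cdot>\<^bsub>K\<^esub> Idt K (Cod K m) = m) \<and>
     (\<forall>l\<in>Arr K. \<forall>m\<in>Arr K. \<forall>n\<in>Arr K. Cod K l = Dom K m \<longrightarrow> Cod K m = Dom K n \<longrightarrow>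
        (l \<cdot>\<^bsub>K\<^esub> m) \<cdot>\<^bsub>K\<^esub> n = l \<cdot>\<^bsub>K\<^esub> (m \<cdot>\<^bsub>K\<^esub> n))"

definition Hom :: "('o, 'm) category \<Rightarrow> 'o \<Rightarrow> 'o \<Rightarrow> 'm set" where
  "Hom K x y = {m \<in> Arr K. Dom K m = x \<and> Cod K m = y}"

definition loopfree :: "('o, 'm) category \<Rightarrow> bool" where
  "loopfree K \<longleftrightarrow>
     (\<forall>x\<in>Obj K. \<forall>y\<in>Obj K. x \<noteq> y \<longrightarrow> Hom K x y = {} \<or> Hom K y x = {}) \<and>
     (\<forall>x\<in>Obj K. Hom K x x = {Idt K x})"

definition poset_category :: "('o, 'm) category \<Rightarrow> bool" where
  "poset_category K \<longleftrightarrow>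
     (\<forall>x\<in>Obj K. \<forall>y\<in>Obj K. \<forall>m\<in>Hom K x y. \<forall>n\<in>Hom K x y. m = n) \<and>
     (\<forall>x\<in>Obj K. \<forall>y\<in>Obj K. x \<noteq> y \<longrightarrow> Hom K x y = {} \<or> Hom K y x = {})"

record ('o, 'm, 'p, 'n) cat_map =
  omap :: "'o \<Rightarrow> 'p"
  mmap :: "'m \<Rightarrow> 'n"

definition is_functor ::
  "('o, 'm) category \<Rightarrow> ('p, 'n) category \<Rightarrow> ('o, 'm, 'p, 'n) cat_map \<Rightarrow> bool" where
  "is_functor K L F \<longleftrightarrow>
     (\<forall>x\<in>Obj K. omap F x \<in> Obj L) \<and>
     (\<forall>m\<in>Arr K. mmap F m \<in> Arr L \<and>
        Dom L (mmap F m) = omap F (Dom K m) \<and> Cod L (mmap F m) = omap F (Cod K m)) \<and>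
     (\<forall>x\<in>Obj K. mmap F (Idt K x) = Idt L (omap F x)) \<and>
     (\<forall>m\<in>Arr K. \<forall>n\<in>Arr K. Cod K m = Dom K n \<longrightarrow>
        mmap F (m \<cdot>\<^bsub>K\<^esub> n) = mmap F m \<cdot>\<^bsub>L\<^esub> mmap F n)"

text \<open>Equality of functors with source \<open>K\<close> ignores the values outside the carriers of \<open>K\<close>.\<close>

definition functor_eq ::
  "('o, 'm) category \<Rightarrow> ('o, 'm, 'p, 'n) cat_map \<Rightarrow> ('o, 'm, 'p, 'n) cat_map \<Rightarrow> bool" where
  "functor_eq K F F' \<longleftrightarrow>
     (\<forall>x\<in>Obj K. omap F x = omap F' x) \<and> (\<forall>m\<in>Arr K. mmap F m = mmap F' m)"

definition id_map :: "('o, 'm, 'o, 'm) cat_map" where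
  "id_map = \<lparr>omap = (\<lambda>x. x), mmap = (\<lambda>m. m)\<rparr>"

text \<open>\<open>comp_map F H\<close> is first \<open>F\<close>, then \<open>H\<close>.\<close>

definition comp_map ::
  "('o, 'm, 'p, 'n) cat_map \<Rightarrow> ('p, 'n, 'q, 'l) cat_map \<Rightarrow> ('o, 'm, 'q, 'l) cat_map" where
  "comp_map F H = \<lparr>omap = omap H \<circ> omap F, mmap = mmap H \<circ> mmap F\<rparr>"


section \<open>Group actions on categories\<close>

text \<open>
  A functor from the one-object category \<open>G\<close> to the category of small categories which sends the
  object to \<open>K\<close>. The order of composition is that of a left action, \<open>(g h) x = g (h x)\<close>. A right
  action becomes a left one by precomposing with inversion in \<open>G\<close>, which changes neither the orbits
  nor the colimit.
\<close>

definition category_action ::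
  "('g, 'z) monoid_scheme \<Rightarrow> ('o, 'm) category \<Rightarrow> ('g \<Rightarrow> ('o, 'm, 'o, 'm) cat_map) \<Rightarrow> bool" where
  "category_action G K A \<longleftrightarrow>
     (\<forall>g\<in>carrier G. is_functor K K (A g)) \<and>
     functor_eq K (A \<one>\<^bsub>G\<^esub>) id_map \<and>
     (\<forall>g\<in>carrier G. \<forall>h\<in>carrier G. functor_eq K (A (g \<otimes>\<^bsub>G\<^esub> h)) (comp_map (A h) (A g)))"

abbreviation obj_orbit ::
  "('g, 'z) monoid_scheme \<Rightarrow> ('g \<Rightarrow> ('o, 'm, 'o, 'm) cat_map) \<Rightarrow> 'o \<Rightarrow> 'o set" where
  "obj_orbit G A \<equiv> orbit G (\<lambda>g. omap (A g))"

abbreviation arr_orbit ::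
  "('g, 'z) monoid_scheme \<Rightarrow> ('g \<Rightarrow> ('o, 'm, 'o, 'm) cat_map) \<Rightarrow> 'm \<Rightarrow> 'm set" where
  "arr_orbit G A \<equiv> orbit G (\<lambda>g. mmap (A g))"

definition acts_regularly ::
  "('g, 'z) monoid_scheme \<Rightarrow> ('o, 'm) category \<Rightarrow> ('g \<Rightarrow> ('o, 'm, 'o, 'm) cat_map) \<Rightarrow> bool" where
  "acts_regularly G K A \<longleftrightarrow>
     (\<forall>x\<in>Arr K. \<forall>ya\<in>Arr K. \<forall>yb\<in>Arr K.
        Cod K x = Dom K ya \<and> Cod K x = Dom K yb \<and> arr_orbit G A ya = arr_orbit G A yb \<longrightarrow>
        arr_orbit G A (x \<cdot>\<^bsub>K\<^esub> ya) = arr_orbit G A (x \<cdot>\<^bsub>K\<^esub> yb))"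

definition condition_SR ::
  "('g, 'z) monoid_scheme \<Rightarrow> ('o, 'm) category \<Rightarrow> ('g \<Rightarrow> ('o, 'm, 'o, 'm) cat_map) \<Rightarrow> bool" where
  "condition_SR G K A \<longleftrightarrow>
     (\<forall>x\<in>Arr K. \<forall>y\<in>Arr K.
        Dom K x = Dom K y \<and> obj_orbit G A (Cod K x) = obj_orbit G A (Cod K y) \<longrightarrow>
        arr_orbit G A x = arr_orbit G A y)"


section \<open>The quotient as a colimit\<close>

text \<open>A cocone under a one-object diagram is a single functor invariant under the action.\<close>

definition is_cocone ::
  "('g, 'z) monoid_scheme \<Rightarrow> ('o, 'm) category \<Rightarrow> ('g \<Rightarrow> ('o, 'm, 'o, 'm) cat_map) \<Rightarrow>
   ('p, 'n) category \<Rightarrow> ('o, 'm, 'p, 'n) cat_map \<Rightarrow> bool" where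
  "is_cocone G K A T f \<longleftrightarrow>
     is_functor K T f \<and> (\<forall>g\<in>carrier G. functor_eq K (comp_map (A g) f) f)"

definition universal_for ::
  "('g, 'z) monoid_scheme \<Rightarrow> ('o, 'm) category \<Rightarrow> ('g \<Rightarrow> ('o, 'm, 'o, 'm) cat_map) \<Rightarrow>
   ('q, 'l) category \<Rightarrow> ('o, 'm, 'q, 'l) cat_map \<Rightarrow> ('p, 'n) category \<Rightarrow> bool" where
  "universal_for G K A Q p T \<longleftrightarrow>
     (\<forall>f. is_cocone G K A T f \<longrightarrow>
        (\<exists>u. is_functor Q T u \<and> functor_eq K (comp_map p u) f \<and>
             (\<forall>v. is_functor Q T v \<and> functor_eq K (comp_map p v) f \<longrightarrow> functor_eq Q v u)))"

text \<open>
  \<open>Q\<close> with coprojection \<open>p\<close> is the colimit \<open>K/G\<close>. The universal property concerns all small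
  categories \<open>T\<close>, but a formula of HOL cannot quantify over the types of the carriers of \<open>T\<close>.
  It is required for \<open>T\<close> with the carrier types of \<open>Q\<close> and for \<open>T\<close> whose objects are sets of
  objects of \<open>K\<close> and whose morphisms are sets of words in the morphisms of \<open>K\<close>. Theorem
  \<open>quotient_universal\<close> below shows that it then holds for \<open>T\<close> of arbitrary types, and theorem
  \<open>quotient_exists\<close> that a colimit exists.
\<close>

definition is_quotient ::
  "('g, 'z) monoid_scheme \<Rightarrow> ('o, 'm) category \<Rightarrow> ('g \<Rightarrow> ('o, 'm, 'o, 'm) cat_map) \<Rightarrow>
   ('q, 'l) category \<Rightarrow> ('o, 'm, 'q, 'l) cat_map \<Rightarrow> bool" where
  "is_quotient G K A Q p \<longleftrightarrow>
     is_category Q \<and> is_cocone G K A Q p \<and>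
     (\<forall>T :: ('q, 'l) category. is_category T \<longrightarrow> universal_for G K A Q p T) \<and>
     (\<forall>T :: ('o set, 'm list set) category. is_category T \<longrightarrow> universal_for G K A Q p T)"


section \<open>Existence of the quotient and its universal property\<close>

text \<open>
  Explicit model: objects are the orbits of objects; morphisms are classes of nonempty words of
  morphisms which are composable up to the action, modulo the congruence generated by the action
  and by composition in \<open>K\<close>.
\<close>

inductive word_eq ::
  "('g, 'z) monoid_scheme \<Rightarrow> ('o, 'm) category \<Rightarrow> ('g \<Rightarrow> ('o, 'm, 'o, 'm) cat_map) \<Rightarrow>
   'm list \<Rightarrow> 'm list \<Rightarrow> bool"
  for G K A where
  act: "m \<in> Arr K \<Longrightarrow> g \<in> carrier G \<Longrightarrow> word_eq G K A [m] [mmap (A g) m]"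
| cmp: "m \<in> Arr K \<Longrightarrow> n \<in> Arr K \<Longrightarrow> Cod K m = Dom K n \<Longrightarrow> word_eq G K A [m, n] [m \<cdot>\<^bsub>K\<^esub> n]"
| refl: "word_eq G K A p p"
| sym: "word_eq G K A p q \<Longrightarrow> word_eq G K A q p"
| trans: "word_eq G K A p q \<Longrightarrow> word_eq G K A q r \<Longrightarrow> word_eq G K A p r"
| app: "word_eq G K A p q \<Longrightarrow> word_eq G K A p' q' \<Longrightarrow> word_eq G K A (p @ p') (q @ q')"

definition word_class ::
  "('g, 'z) monoid_scheme \<Rightarrow> ('o, 'm) category \<Rightarrow> ('g \<Rightarrow> ('o, 'm, 'o, 'm) cat_map) \<Rightarrow>
   'm list \<Rightarrow> 'm list set" where
  "word_class G K A p = {q. word_eq G K A p q}"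

definition word_dom ::
  "('g, 'z) monoid_scheme \<Rightarrow> ('o, 'm) category \<Rightarrow> ('g \<Rightarrow> ('o, 'm, 'o, 'm) cat_map) \<Rightarrow>
   'm list \<Rightarrow> 'o set" where
  "word_dom G K A p = obj_orbit G A (Dom K (hd p))"

definition word_cod ::
  "('g, 'z) monoid_scheme \<Rightarrow> ('o, 'm) category \<Rightarrow> ('g \<Rightarrow> ('o, 'm, 'o, 'm) cat_map) \<Rightarrow>
   'm list \<Rightarrow> 'o set" where
  "word_cod G K A p = obj_orbit G A (Cod K (last p))"

fun linked ::
  "('g, 'z) monoid_scheme \<Rightarrow> ('o, 'm) category \<Rightarrow> ('g \<Rightarrow> ('o, 'm, 'o, 'm) cat_map) \<Rightarrow>
   'm list \<Rightarrow> bool" where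
  "linked G K A [] = True"
| "linked G K A [m] = (m \<in> Arr K)"
| "linked G K A (m # n # r) =
     (m \<in> Arr K \<and> obj_orbit G A (Cod K m) = obj_orbit G A (Dom K n) \<and> linked G K A (n # r))"

definition quotient_model ::
  "('g, 'z) monoid_scheme \<Rightarrow> ('o, 'm) category \<Rightarrow> ('g \<Rightarrow> ('o, 'm, 'o, 'm) cat_map) \<Rightarrow>
   ('o set, 'm list set) category" where
  "quotient_model G K A =
     \<lparr>Obj = obj_orbit G A ` Obj K,
      Arr = word_class G K A ` {p. p \<noteq> [] \<and> linked G K A p},
      Dom = (\<lambda>c. word_dom G K A (SOME p. p \<in> c)),
      Cod = (\<lambda>c. word_cod G K A (SOME p. p \<in> c)),
      Idt = (\<lambda>b. word_class G K A [Idt K (SOME x. x \<in> b)]),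
      Cmp = (\<lambda>c d. word_class G K A ((SOME p. p \<in> c) @ (SOME q. q \<in> d)))\<rparr>"

definition quotient_proj ::
  "('g, 'z) monoid_scheme \<Rightarrow> ('o, 'm) category \<Rightarrow> ('g \<Rightarrow> ('o, 'm, 'o, 'm) cat_map) \<Rightarrow>
   ('o, 'm, 'o set, 'm list set) cat_map" where
  "quotient_proj G K A =
     \<lparr>omap = obj_orbit G A, mmap = (\<lambda>m. word_class G K A [m])\<rparr>"

fun eval_word :: "('p, 'n) category \<Rightarrow> ('m \<Rightarrow> 'n) \<Rightarrow> 'm list \<Rightarrow> 'n" where
  "eval_word T f [] = undefined"
| "eval_word T f [m] = f m"
| "eval_word T f (m # n # r) = f m \<cdot>\<^bsub>T\<^esub> eval_word T f (n # r)"

context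
  fixes G :: "('g, 'z) monoid_scheme" and K :: "('o, 'm) category"
    and A :: "'g \<Rightarrow> ('o, 'm, 'o, 'm) cat_map"
  assumes G: "group G" and K: "is_category K" and act: "category_action G K A"
begin

interpretation group G by (rule G)

private abbreviation "oo \<equiv> obj_orbit G A"
private abbreviation "weq \<equiv> word_eq G K A"
private abbreviation "cls \<equiv> word_class G K A"
private abbreviation "wd \<equiv> word_dom G K A"
private abbreviation "wc \<equiv> word_cod G K A"
private abbreviation "lk \<equiv> linked G K A"
private abbreviation "C \<equiv> quotient_model G K A"

lemma action_simps:
  assumes "g \<in> carrier G"
  shows "x \<in> Obj K \<Longrightarrow> omap (A g) x \<in> Obj K"
    and "m \<in> Arr K \<Longrightarrow> mmap (A g) m \<in> Arr K"
    and "m \<in> Arr K \<Longrightarrow> Dom K (mmap (A g) m) = omap (A g) (Dom K m)"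
    and "m \<in> Arr K \<Longrightarrow> Cod K (mmap (A g) m) = omap (A g) (Cod K m)"
    and "x \<in> Obj K \<Longrightarrow> mmap (A g) (Idt K x) = Idt K (omap (A g) x)"
  using act assms unfolding category_action_def is_functor_def by auto

lemma action_one: "x \<in> Obj K \<Longrightarrow> omap (A \<one>\<^bsub>G\<^esub>) x = x"
  using act unfolding category_action_def functor_eq_def id_map_def by auto

lemma action_mult:
  "g \<in> carrier G \<Longrightarrow> h \<in> carrier G \<Longrightarrow> x \<in> Obj K \<Longrightarrow>
   omap (A (g \<otimes>\<^bsub>G\<^esub> h)) x = omap (A g) (omap (A h) x)"
  using act unfolding category_action_def functor_eq_def comp_map_def by auto

lemma cat_simps:
  shows "m \<in> Arr K \<Longrightarrow> Dom K m \<in> Obj K" "m \<in> Arr K \<Longrightarrow> Cod K m \<in> Obj K"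
    and "x \<in> Obj K \<Longrightarrow> Idt K x \<in> Arr K"
    and "x \<in> Obj K \<Longrightarrow> Dom K (Idt K x) = x" "x \<in> Obj K \<Longrightarrow> Cod K (Idt K x) = x"
    and "m \<in> Arr K \<Longrightarrow> n \<in> Arr K \<Longrightarrow> Cod K m = Dom K n \<Longrightarrow> m \<cdot>\<^bsub>K\<^esub> n \<in> Arr K"
    and "m \<in> Arr K \<Longrightarrow> n \<in> Arr K \<Longrightarrow> Cod K m = Dom K n \<Longrightarrow> Dom K (m \<cdot>\<^bsub>K\<^esub> n) = Dom K m"
    and "m \<in> Arr K \<Longrightarrow> n \<in> Arr K \<Longrightarrow> Cod K m = Dom K n \<Longrightarrow> Cod K (m \<cdot>\<^bsub>K\<^esub> n) = Cod K n"
    and "m \<in> Arr K \<Longrightarrow> Idt K (Dom K m) \<cdot>\<^bsub>K\<^esub> m = m"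
    and "m \<in> Arr K \<Longrightarrow> m \<cdot>\<^bsub>K\<^esub> Idt K (Cod K m) = m"
  using K unfolding is_category_def by auto

lemma orbit_self: "x \<in> Obj K \<Longrightarrow> x \<in> oo x"
  unfolding orbit_def using action_one by (auto intro!: exI[of _ "\<one>\<^bsub>G\<^esub>"])

lemma orbit_shift:
  assumes g: "g \<in> carrier G" and x: "x \<in> Obj K"
  shows "oo (omap (A g) x) = oo x"
proof -
  have "\<exists>k\<in>carrier G. omap (A h) (omap (A g) x) = omap (A k) x" if "h \<in> carrier G" for h
    using that g x action_mult[of h g x] by (intro bexI[of _ "h \<otimes>\<^bsub>G\<^esub> g"]) auto
  moreover have "\<exists>k\<in>carrier G. omap (A h) x = omap (A k) (omap (A g) x)"
    if "h \<in> carrier G" for h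
    using that g x action_mult[of "h \<otimes>\<^bsub>G\<^esub> inv\<^bsub>G\<^esub> g" g x]
    by (intro bexI[of _ "h \<otimes>\<^bsub>G\<^esub> inv\<^bsub>G\<^esub> g"]) (auto simp: m_assoc)
  ultimately show ?thesis unfolding orbit_def by fastforce
qed

lemma orbit_memD:
  assumes "y \<in> oo x" "x \<in> Obj K"
  shows "y \<in> Obj K" "oo y = oo x" "\<exists>g\<in>carrier G. y = omap (A g) x"
proof -
  obtain g where g: "g \<in> carrier G" "y = omap (A g) x"
    using assms unfolding orbit_def by auto
  show "y \<in> Obj K" "oo y = oo x" "\<exists>g\<in>carrier G. y = omap (A g) x"
    using g assms(2) orbit_shift action_simps(1) by auto
qed

lemma orbit_eqD:
  assumes "oo x = oo y" "y \<in> Obj K" "x \<in> Obj K"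
  shows "\<exists>g\<in>carrier G. y = omap (A g) x"
  using assms orbit_memD(3)[of y x] orbit_self[of y] by auto

lemma orbit_rep:
  assumes "x \<in> Obj K"
  shows "(SOME y. y \<in> oo x) \<in> Obj K" "oo (SOME y. y \<in> oo x) = oo x"
    "\<exists>g\<in>carrier G. (SOME y. y \<in> oo x) = omap (A g) x"
proof -
  have "(SOME y. y \<in> oo x) \<in> oo x" using orbit_self[OF assms] by (rule someI)
  from orbit_memD[OF this assms]
  show "(SOME y. y \<in> oo x) \<in> Obj K" "oo (SOME y. y \<in> oo x) = oo x"
    "\<exists>g\<in>carrier G. (SOME y. y \<in> oo x) = omap (A g) x" .
qed

lemma linked_app:
  "p \<noteq> [] \<Longrightarrow> q \<noteq> [] \<Longrightarrow> lk (p @ q) \<longleftrightarrow> lk p \<and> lk q \<and> wc p = wd q"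
proof (induction p rule: induct_list012)
  case (2 x)
  then show ?case by (cases q) (auto simp: word_dom_def word_cod_def)
qed (auto simp: word_dom_def word_cod_def)

lemma word_eq_inv:
  "weq p q \<Longrightarrow> (p = [] \<longleftrightarrow> q = []) \<and> (lk p \<longleftrightarrow> lk q) \<and> (p \<noteq> [] \<longrightarrow> wd p = wd q \<and> wc p = wc q)"
proof (induction rule: word_eq.induct)
  case (act m g)
  then show ?case
    by (simp add: word_dom_def word_cod_def action_simps cat_simps orbit_shift)
next
  case (cmp m n)
  then show ?case by (simp add: word_dom_def word_cod_def cat_simps)
next
  case (app p q p' q')
  then show ?case
    by (cases "p = []"; cases "p' = []") (auto simp: linked_app word_dom_def word_cod_def)
qed auto

lemma cls_self: "p \<in> cls p"
  unfolding word_class_def by (simp add: word_eq.refl)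

lemma cls_eq: "weq p q \<longleftrightarrow> cls p = cls q"
  unfolding word_class_def by (auto intro: word_eq.intros)

lemma rep_eq: "weq p (SOME q. q \<in> cls p)"
proof -
  have "(SOME q. q \<in> cls p) \<in> cls p" using cls_self by (rule someI)
  thus ?thesis unfolding word_class_def by simp
qed

lemma model_Obj: "Obj C = oo ` Obj K"
  by (simp add: quotient_model_def)

lemma model_Arr: "Arr C = cls ` {p. p \<noteq> [] \<and> lk p}"
  by (simp add: quotient_model_def)

lemma model_Dom: "p \<noteq> [] \<Longrightarrow> Dom C (cls p) = wd p"
  using word_eq_inv[OF rep_eq, of p] by (simp add: quotient_model_def)

lemma model_Cod: "p \<noteq> [] \<Longrightarrow> Cod C (cls p) = wc p"
  using word_eq_inv[OF rep_eq, of p] by (simp add: quotient_model_def)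

lemma model_Cmp: "cls p \<cdot>\<^bsub>C\<^esub> cls q = cls (p @ q)"
  using word_eq.app[OF rep_eq rep_eq, of p q] by (simp add: quotient_model_def cls_eq)

lemma model_Idt:
  assumes "x \<in> Obj K"
  shows "Idt C (oo x) = cls [Idt K x]"
proof -
  obtain g where g: "g \<in> carrier G" "(SOME y. y \<in> oo x) = omap (A g) x"
    using orbit_rep(3)[OF assms] by auto
  have "weq [Idt K x] [Idt K (omap (A g) x)]"
    using word_eq.act[of "Idt K x" K g G A] g assms by (simp add: action_simps cat_simps)
  thus ?thesis using g by (simp add: quotient_model_def cls_eq)
qed

lemma wd_Obj: "p \<noteq> [] \<Longrightarrow> lk p \<Longrightarrow> \<exists>x\<in>Obj K. wd p = oo x \<and> x = Dom K (hd p)"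
  by (induction p rule: induct_list012) (auto simp: word_dom_def cat_simps)

lemma wc_Obj: "p \<noteq> [] \<Longrightarrow> lk p \<Longrightarrow> \<exists>x\<in>Obj K. wc p = oo x \<and> x = Cod K (last p)"
  by (induction p rule: induct_list012) (auto simp: word_cod_def cat_simps)

lemma linked_hd: "p \<noteq> [] \<Longrightarrow> lk p \<Longrightarrow> hd p \<in> Arr K"
  by (induction p rule: induct_list012) auto

lemma linked_last: "p \<noteq> [] \<Longrightarrow> lk p \<Longrightarrow> last p \<in> Arr K"
  by (induction p rule: induct_list012) auto

lemma word_id_left:
  assumes "p \<noteq> []" "lk p"
  shows "weq (Idt K (Dom K (hd p)) # p) p"
proof -
  have "weq [Idt K (Dom K (hd p)), hd p] [hd p]"
    using word_eq.cmp[of "Idt K (Dom K (hd p))" K "hd p" G A] linked_hd[OF assms]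
    by (simp add: cat_simps)
  from word_eq.app[OF this word_eq.refl[of _ _ _ "tl p"]] show ?thesis using assms by simp
qed

lemma word_id_right:
  assumes "p \<noteq> []" "lk p"
  shows "weq (p @ [Idt K (Cod K (last p))]) p"
proof -
  have "weq [last p, Idt K (Cod K (last p))] [last p]"
    using word_eq.cmp[of "last p" K "Idt K (Cod K (last p))" G A] linked_last[OF assms]
    by (simp add: cat_simps)
  from word_eq.app[OF word_eq.refl[of _ _ _ "butlast p"] this]
  have "weq (butlast p @ [last p] @ [Idt K (Cod K (last p))]) (butlast p @ [last p])" by simp
  thus ?thesis using assms by (metis append_assoc append_butlast_last_id)
qed

lemma model_category: "is_category C"
  unfolding is_category_def
proof (intro conjI ballI impI)
  fix c assume "c \<in> Arr C"
  then obtain p where p: "c = cls p" "p \<noteq> []" "lk p" by (auto simp: model_Arr)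
  show "Dom C c \<in> Obj C" using wd_Obj p by (fastforce simp: model_Dom model_Obj)
  show "Cod C c \<in> Obj C" using wc_Obj p by (fastforce simp: model_Cod model_Obj)
  have h: "hd p \<in> Arr K" "last p \<in> Arr K" using p linked_hd linked_last by auto
  show "Idt C (Dom C c) \<cdot>\<^bsub>C\<^esub> c = c"
    using word_id_left[of p] p h
    by (simp add: model_Dom word_dom_def model_Idt cat_simps model_Cmp cls_eq)
  show "c \<cdot>\<^bsub>C\<^esub> Idt C (Cod C c) = c"
    using word_id_right[of p] p h
    by (simp add: model_Cod word_cod_def model_Idt cat_simps model_Cmp cls_eq)
  fix d assume "d \<in> Arr C"
  then obtain q where q: "d = cls q" "q \<noteq> []" "lk q" by (auto simp: model_Arr)
  {
    assume "Cod C c = Dom C d"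
    hence e: "wc p = wd q" using p q by (simp add: model_Dom model_Cod)
    show "c \<cdot>\<^bsub>C\<^esub> d \<in> Arr C" using p q e by (auto simp: model_Cmp model_Arr linked_app)
    show "Dom C (c \<cdot>\<^bsub>C\<^esub> d) = Dom C c" using p q by (simp add: model_Cmp model_Dom word_dom_def)
    show "Cod C (c \<cdot>\<^bsub>C\<^esub> d) = Cod C d" using p q by (simp add: model_Cmp model_Cod word_cod_def)
  }
  fix e assume "e \<in> Arr C"
  then obtain r where r: "e = cls r" by (auto simp: model_Arr)
  show "c \<cdot>\<^bsub>C\<^esub> d \<cdot>\<^bsub>C\<^esub> e = c \<cdot>\<^bsub>C\<^esub> (d \<cdot>\<^bsub>C\<^esub> e)" using p q r by (simp add: model_Cmp)
next
  fix b assume "b \<in> Obj C"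
  then obtain x where x: "b = oo x" "x \<in> Obj K" by (auto simp: model_Obj)
  show "Idt C b \<in> Arr C" "Dom C (Idt C b) = b" "Cod C (Idt C b) = b"
    using x by (auto simp: model_Idt model_Dom model_Cod word_dom_def word_cod_def model_Arr cat_simps)
qed

lemma proj_cocone: "is_cocone G K A C (quotient_proj G K A)"
  unfolding is_cocone_def is_functor_def functor_eq_def
proof (intro conjI ballI impI)
  fix m assume m: "m \<in> Arr K"
  show "mmap (quotient_proj G K A) m \<in> Arr C"
    "Dom C (mmap (quotient_proj G K A) m) = omap (quotient_proj G K A) (Dom K m)"
    "Cod C (mmap (quotient_proj G K A) m) = omap (quotient_proj G K A) (Cod K m)"
    using m by (auto simp: quotient_proj_def model_Arr model_Dom model_Cod word_dom_def word_cod_def)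
  fix n assume "n \<in> Arr K" "Cod K m = Dom K n"
  thus "mmap (quotient_proj G K A) (m \<cdot>\<^bsub>K\<^esub> n)
      = mmap (quotient_proj G K A) m \<cdot>\<^bsub>C\<^esub> mmap (quotient_proj G K A) n"
    using m word_eq.cmp[of m K n G A] by (simp add: quotient_proj_def model_Cmp cls_eq)
next
  fix g m assume "g \<in> carrier G" "m \<in> Arr K"
  thus "mmap (comp_map (A g) (quotient_proj G K A)) m = mmap (quotient_proj G K A) m"
    using word_eq.act[of m K g G A] by (simp add: quotient_proj_def comp_map_def cls_eq)
next
  fix x assume x: "x \<in> Obj K"
  show "omap (quotient_proj G K A) x \<in> Obj C" using x by (simp add: quotient_proj_def model_Obj)
  show "mmap (quotient_proj G K A) (Idt K x) = Idt C (omap (quotient_proj G K A) x)"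
    using x by (simp add: quotient_proj_def model_Idt)
  fix g assume "g \<in> carrier G"
  thus "omap (comp_map (A g) (quotient_proj G K A)) x = omap (quotient_proj G K A) x"
    using x by (simp add: quotient_proj_def comp_map_def orbit_shift)
qed

lemma model_universal:
  fixes T :: "('p, 'n) category"
  assumes T: "is_category T"
  shows "universal_for G K A C (quotient_proj G K A) T"
  unfolding universal_for_def
proof (intro allI impI)
  fix f assume f: "is_cocone G K A T f"
  have fo: "x \<in> Obj K \<Longrightarrow> omap f x \<in> Obj T" for x
    using f unfolding is_cocone_def is_functor_def by auto
  have fm: "m \<in> Arr K \<Longrightarrow> mmap f m \<in> Arr T" "m \<in> Arr K \<Longrightarrow> Dom T (mmap f m) = omap f (Dom K m)"
     "m \<in> Arr K \<Longrightarrow> Cod T (mmap f m) = omap f (Cod K m)" for m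
    using f unfolding is_cocone_def is_functor_def by auto
  have fi: "x \<in> Obj K \<Longrightarrow> mmap f (Idt K x) = Idt T (omap f x)" for x
    using f unfolding is_cocone_def is_functor_def by auto
  have fc: "m \<in> Arr K \<Longrightarrow> n \<in> Arr K \<Longrightarrow> Cod K m = Dom K n \<Longrightarrow>
      mmap f (m \<cdot>\<^bsub>K\<^esub> n) = mmap f m \<cdot>\<^bsub>T\<^esub> mmap f n" for m n
    using f unfolding is_cocone_def is_functor_def by auto
  have ga: "g \<in> carrier G \<Longrightarrow> x \<in> Obj K \<Longrightarrow> omap f (omap (A g) x) = omap f x"
    "g \<in> carrier G \<Longrightarrow> m \<in> Arr K \<Longrightarrow> mmap f (mmap (A g) m) = mmap f m" for g x m
    using f unfolding is_cocone_def functor_eq_def comp_map_def by auto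
  have oe: "oo x = oo y \<Longrightarrow> x \<in> Obj K \<Longrightarrow> y \<in> Obj K \<Longrightarrow> omap f x = omap f y" for x y
    using orbit_eqD[of x y] ga(1) by auto
  have Tc: "m \<in> Arr T \<Longrightarrow> n \<in> Arr T \<Longrightarrow> Cod T m = Dom T n \<Longrightarrow>
      m \<cdot>\<^bsub>T\<^esub> n \<in> Arr T \<and> Dom T (m \<cdot>\<^bsub>T\<^esub> n) = Dom T m \<and> Cod T (m \<cdot>\<^bsub>T\<^esub> n) = Cod T n" for m n
    using T unfolding is_category_def by auto
  have Ta: "l \<in> Arr T \<Longrightarrow> m \<in> Arr T \<Longrightarrow> n \<in> Arr T \<Longrightarrow> Cod T l = Dom T m \<Longrightarrow> Cod T m = Dom T n \<Longrightarrow>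
      l \<cdot>\<^bsub>T\<^esub> m \<cdot>\<^bsub>T\<^esub> n = l \<cdot>\<^bsub>T\<^esub> (m \<cdot>\<^bsub>T\<^esub> n)" for l m n
    using T unfolding is_category_def by auto
  define ev where "ev = eval_word T (mmap f)"
  have ev1: "ev [m] = mmap f m" for m by (simp add: ev_def)
  have ev2: "p \<noteq> [] \<Longrightarrow> ev (m # p) = mmap f m \<cdot>\<^bsub>T\<^esub> ev p" for m p
    by (cases p) (auto simp: ev_def)
  have evT: "p \<noteq> [] \<Longrightarrow> lk p \<Longrightarrow>
      ev p \<in> Arr T \<and> Dom T (ev p) = omap f (Dom K (hd p)) \<and> Cod T (ev p) = omap f (Cod K (last p))" for p
  proof (induction p rule: induct_list012)
    case (3 m n r)
    have "Cod T (mmap f m) = Dom T (ev (n # r))"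
      using 3 oe[of "Cod K m" "Dom K n"] linked_hd[of "n # r"] by (simp add: fm cat_simps)
    thus ?case using 3 Tc[of "mmap f m" "ev (n # r)"] by (simp add: ev2 fm)
  qed (auto simp: ev1 fm)
  have evapp: "p \<noteq> [] \<Longrightarrow> q \<noteq> [] \<Longrightarrow> lk (p @ q) \<Longrightarrow> ev (p @ q) = ev p \<cdot>\<^bsub>T\<^esub> ev q" for p q
  proof (induction p rule: induct_list012)
    case (2 m) then show ?case by (simp add: ev1 ev2)
  next
    case (3 m n r)
    have l: "lk (n # r)" "lk q" "wc (n # r) = wd q"
      using 3 linked_app[of "n # r" q] by auto
    have 1: "Cod T (mmap f m) = Dom T (ev (n # r))"
      using 3 oe[of "Cod K m" "Dom K n"] linked_hd[of "n # r"] evT[of "n # r"] l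
      by (simp add: fm cat_simps)
    have 2: "Cod T (ev (n # r)) = Dom T (ev q)"
      using 3 l evT[of "n # r"] evT[of q] oe[of "Cod K (last (n # r))" "Dom K (hd q)"]
        linked_hd[of q] linked_last[of "n # r"]
      by (simp add: word_cod_def word_dom_def cat_simps del: last.simps)
    have "ev ((m # n # r) @ q) = mmap f m \<cdot>\<^bsub>T\<^esub> (ev (n # r) \<cdot>\<^bsub>T\<^esub> ev q)"
      using 3 by (simp add: ev2)
    also have "\<dots> = mmap f m \<cdot>\<^bsub>T\<^esub> ev (n # r) \<cdot>\<^bsub>T\<^esub> ev q"
      using Ta[of "mmap f m" "ev (n # r)" "ev q"] 1 2 3 l evT[of "n # r"] evT[of q] fm by simp
    finally show ?case by (simp add: ev2)
  qed simp
  have evq: "weq p q \<Longrightarrow> p \<noteq> [] \<Longrightarrow> lk p \<Longrightarrow> ev p = ev q" for p q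
  proof (induction rule: word_eq.induct)
    case (app p q p' q')
    note i = word_eq_inv[OF app.hyps(1)] word_eq_inv[OF app.hyps(2)]
    show ?case
    proof (cases "p = [] \<or> p' = []")
      case True then show ?thesis using app i by auto
    next
      case False
      hence "lk (q @ q')" using app.prems i linked_app[of p p'] linked_app[of q q'] by auto
      thus ?thesis using False app i evapp[of p p'] evapp[of q q'] linked_app[of p p'] by auto
    qed
  next
    case (sym p q) then show ?case using word_eq_inv[OF sym.hyps(1)] by auto
  next
    case (trans p q r) then show ?case using word_eq_inv[OF trans.hyps(1)] by auto
  qed (auto simp: ev1 ev2 ga fc)
  define u where "u = \<lparr>omap = (\<lambda>b. omap f (SOME x. x \<in> b)), mmap = (\<lambda>c. ev (SOME p. p \<in> c))\<rparr>"
  have uo: "omap u (oo x) = omap f x" if "x \<in> Obj K" for x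
    using oe[OF orbit_rep(2)[OF that] orbit_rep(1)[OF that] that] by (simp add: u_def)
  have um: "mmap u (cls p) = ev p" if "p \<noteq> []" "lk p" for p
    using evq[OF rep_eq that] by (simp add: u_def)
  have uf: "is_functor C T u"
    unfolding is_functor_def
  proof (intro conjI ballI impI)
    fix c assume "c \<in> Arr C"
    then obtain p where p: "c = cls p" "p \<noteq> []" "lk p" by (auto simp: model_Arr)
    show "mmap u c \<in> Arr T" using p um evT by auto
    show "Dom T (mmap u c) = omap u (Dom C c)"
      using p um evT[of p] uo linked_hd[of p] by (simp add: model_Dom word_dom_def cat_simps)
    show "Cod T (mmap u c) = omap u (Cod C c)"
      using p um evT[of p] uo linked_last[of p] by (simp add: model_Cod word_cod_def cat_simps)
    fix d assume "d \<in> Arr C" and e: "Cod C c = Dom C d"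
    then obtain q where q: "d = cls q" "q \<noteq> []" "lk q" by (auto simp: model_Arr)
    have "lk (p @ q)" using p q e linked_app[of p q] by (simp add: model_Cod model_Dom)
    thus "mmap u (c \<cdot>\<^bsub>C\<^esub> d) = mmap u c \<cdot>\<^bsub>T\<^esub> mmap u d"
      using p q um[of "p @ q"] um evapp by (simp add: model_Cmp)
  qed (auto simp: model_Obj uo fo model_Idt um cat_simps ev1 fi)
  have ue: "functor_eq K (comp_map (quotient_proj G K A) u) f"
    unfolding functor_eq_def by (auto simp: comp_map_def quotient_proj_def uo um ev1)
  have "functor_eq C v u"
    if v: "is_functor C T v" "functor_eq K (comp_map (quotient_proj G K A) v) f" for v
  proof -
    have vo: "x \<in> Obj K \<Longrightarrow> omap v (oo x) = omap f x" for x
      using v(2) by (simp add: functor_eq_def comp_map_def quotient_proj_def)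
    have v1: "m \<in> Arr K \<Longrightarrow> mmap v (cls [m]) = mmap f m" for m
      using v(2) by (simp add: functor_eq_def comp_map_def quotient_proj_def)
    have "p \<noteq> [] \<Longrightarrow> lk p \<Longrightarrow> mmap v (cls p) = ev p" for p
    proof (induction p rule: induct_list012)
      case (3 m n r)
      have "cls [m] \<in> Arr C" "cls (n # r) \<in> Arr C" "Cod C (cls [m]) = Dom C (cls (n # r))"
        using 3 by (auto simp: model_Arr model_Cod model_Dom word_dom_def word_cod_def)
      hence "mmap v (cls [m] \<cdot>\<^bsub>C\<^esub> cls (n # r)) = mmap v (cls [m]) \<cdot>\<^bsub>T\<^esub> mmap v (cls (n # r))"
        using v(1) unfolding is_functor_def by blast
      then show ?case using 3 by (simp add: model_Cmp v1 ev2)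
    qed (auto simp: v1 ev1)
    thus ?thesis unfolding functor_eq_def by (auto simp: model_Obj model_Arr vo uo um)
  qed
  thus "\<exists>u. is_functor C T u \<and> functor_eq K (comp_map (quotient_proj G K A) u) f \<and>
      (\<forall>v. is_functor C T v \<and> functor_eq K (comp_map (quotient_proj G K A) v) f \<longrightarrow> functor_eq C v u)"
    using uf ue by blast
qed

theorem quotient_exists: "is_quotient G K A C (quotient_proj G K A)"
  unfolding is_quotient_def using model_category proj_cocone model_universal by blast

theorem quotient_universal:
  fixes Q :: "('q, 'l) category" and T :: "('p, 'n) category"
  assumes Q: "is_quotient G K A Q p" and T: "is_category T"
  shows "universal_for G K A Q p T"
  unfolding universal_for_def
proof (intro allI impI)
  let ?pr = "quotient_proj G K A"
  have comp: "is_functor X Z (comp_map a b)" if "is_functor X Y a" "is_functor Y Z b"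
    for X :: "('a, 'b) category" and Y :: "('c, 'd) category" and Z :: "('e, 'f) category" and a b
    using that unfolding is_functor_def comp_map_def by auto
  have Qc: "is_category Q" "is_cocone G K A Q p" "is_functor K Q p"
    using Q unfolding is_quotient_def is_cocone_def by auto
  have pf: "is_functor K C ?pr" using proj_cocone unfolding is_cocone_def by auto
  have "universal_for G K A Q p C" using Q model_category unfolding is_quotient_def by blast
  then obtain a where a: "is_functor Q C a" "functor_eq K (comp_map p a) ?pr"
    using proj_cocone unfolding universal_for_def by blast
  obtain b where b: "is_functor C Q b" "functor_eq K (comp_map ?pr b) p"
    using model_universal[OF Qc(1)] Qc(2) unfolding universal_for_def by blast
  have uQ: "universal_for G K A Q p Q" using Q Qc(1) unfolding is_quotient_def by blast
  have ab: "is_functor Q Q (comp_map a b)" by (rule comp[OF a(1) b(1)])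
  have abe: "functor_eq K (comp_map p (comp_map a b)) p"
    using a(2) b(2) unfolding functor_eq_def comp_map_def by auto
  have id: "is_functor Q Q id_map" "functor_eq K (comp_map p id_map) p"
    using Qc(1) unfolding is_functor_def id_map_def functor_eq_def comp_map_def is_category_def
    by auto
  obtain z where "\<And>v. is_functor Q Q v \<Longrightarrow> functor_eq K (comp_map p v) p \<Longrightarrow> functor_eq Q v z"
    using uQ Qc(2) unfolding universal_for_def by blast
  from this[OF ab abe] this[OF id] have abid: "functor_eq Q (comp_map a b) id_map"
    unfolding functor_eq_def by simp
  fix f assume f: "is_cocone G K A T f"
  obtain w where w: "is_functor C T w" "functor_eq K (comp_map ?pr w) f"
    and wu: "\<And>v. is_functor C T v \<Longrightarrow> functor_eq K (comp_map ?pr v) f \<Longrightarrow> functor_eq C v w"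
    using model_universal[OF T] f unfolding universal_for_def by blast
  have 1: "is_functor Q T (comp_map a w)" by (rule comp[OF a(1) w(1)])
  have 2: "functor_eq K (comp_map p (comp_map a w)) f"
    using a(2) w(2) unfolding functor_eq_def comp_map_def by auto
  have 3: "functor_eq Q v (comp_map a w)"
    if v: "is_functor Q T v" "functor_eq K (comp_map p v) f" for v
  proof -
    have "functor_eq K (comp_map ?pr (comp_map b v)) f"
      using b(2) v(2) unfolding functor_eq_def comp_map_def by auto
    hence e: "functor_eq C (comp_map b v) w" using wu comp[OF b(1) v(1)] by blast
    show ?thesis
      unfolding functor_eq_def
    proof (intro conjI ballI)
      fix x assume x: "x \<in> Obj Q"
      have "omap a x \<in> Obj C" using a(1) x unfolding is_functor_def by blast
      hence "omap v (omap b (omap a x)) = omap w (omap a x)"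
        using e unfolding functor_eq_def comp_map_def by simp
      moreover have "omap b (omap a x) = x"
        using abid x unfolding functor_eq_def comp_map_def id_map_def by simp
      ultimately show "omap v x = omap (comp_map a w) x" by (simp add: comp_map_def)
    next
      fix m assume m: "m \<in> Arr Q"
      have "mmap a m \<in> Arr C" using a(1) m unfolding is_functor_def by blast
      hence "mmap v (mmap b (mmap a m)) = mmap w (mmap a m)"
        using e unfolding functor_eq_def comp_map_def by simp
      moreover have "mmap b (mmap a m) = m"
        using abid m unfolding functor_eq_def comp_map_def id_map_def by simp
      ultimately show "mmap v m = mmap (comp_map a w) m" by (simp add: comp_map_def)
    qed
  qed
  show "\<exists>u. is_functor Q T u \<and> functor_eq K (comp_map p u) f \<and>
      (\<forall>v. is_functor Q T v \<and> functor_eq K (comp_map p v) f \<longrightarrow> functor_eq Q v u)"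
    using 1 2 3 by blast
qed

end

end

theory Submission
  imports Defs
begin

text \<open>
  If the action is regular, then the composite of two orbits of morphisms does not depend on the
  composable representatives: if \<open>y' = h y\<close> is composable with \<open>x' = g x\<close>, then \<open>g\<^sup>-\<^sup>1 y'\<close> and \<open>y\<close>
  lie in one orbit and are both composable with \<open>x\<close>. Hence the orbits of objects and the orbits of
  morphisms form a category, and this orbit category is the colimit \<open>K/G\<close>
  (lemmas \<open>orbit_category_category\<close>, \<open>orbit_proj_cocone\<close>, \<open>orbit_category_universal\<close>). Any other
  colimit embeds into it compatibly with the projections (lemma \<open>colimit_comparison\<close>).

  Condition (SR) implies regularity, because \<open>x \<cdot> y\<^sub>a\<close> and \<open>x \<cdot> y\<^sub>b\<close> have the same source and targets
  in one orbit. It also says that the orbit category has at most one morphism between two objects,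
  since any two parallel orbits have representatives with a common source. Morphisms in both
  directions between two orbits give \<open>m : x \<rightarrow> y\<close> and \<open>n : y \<rightarrow> g x\<close> in \<open>K\<close>; by (SR) the composite
  \<open>m \<cdot> n\<close> lies in the orbit of the identity of \<open>x\<close>, so it is an identity, \<open>g x = x\<close>, and
  loopfreeness gives \<open>x = y\<close>.

  Conversely, if the action is regular and \<open>K/G\<close> is a poset, then morphisms \<open>x\<close>, \<open>y\<close> as in (SR) have
  parallel, hence equal, images in \<open>K/G\<close>. Their images in the orbit category are then equal too, and
  these are their orbits.
\<close>

section \<open>Comparison of colimits\<close>

lemma functor_comp:
  assumes "is_functor X Y a" "is_functor Y Z b"
  shows "is_functor X Z (comp_map a b)"
  using assms unfolding is_functor_def comp_map_def by auto

text \<open>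
  The functor \<open>a\<close> from \<open>Q\<close> to \<open>T\<close> induced by the cocone \<open>q\<close> has a left inverse, the functor \<open>b\<close> from \<open>T\<close>
  to \<open>Q\<close> induced by \<open>p\<close>: the composite and the identity both factor \<open>p\<close> through itself. Injectivity
  of \<open>a\<close> is all that the comparison of posets needs.
\<close>

lemma colimit_comparison:
  assumes Q: "is_category Q" "is_cocone G K A Q p"
    and T: "is_cocone G K A T q"
    and QQ: "universal_for G K A Q p Q" and QT: "universal_for G K A Q p T"
    and TQ: "universal_for G K A T q Q"
  shows "\<exists>a. is_functor Q T a \<and> functor_eq K (comp_map p a) q \<and>
    inj_on (omap a) (Obj Q) \<and> inj_on (mmap a) (Arr Q)"
proof -
  obtain a where a: "is_functor Q T a" "functor_eq K (comp_map p a) q"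
    using QT T unfolding universal_for_def by blast
  obtain b where b: "is_functor T Q b" "functor_eq K (comp_map q b) p"
    using TQ Q(2) unfolding universal_for_def by blast
  have ab: "is_functor Q Q (comp_map a b)" "functor_eq K (comp_map p (comp_map a b)) p"
    using functor_comp[OF a(1) b(1)] a(2) b(2) unfolding functor_eq_def comp_map_def by auto
  have id: "is_functor Q Q id_map" "functor_eq K (comp_map p id_map) p"
    using Q(1) unfolding is_functor_def id_map_def functor_eq_def comp_map_def is_category_def
    by auto
  obtain z where
    "\<And>v. is_functor Q Q v \<Longrightarrow> functor_eq K (comp_map p v) p \<Longrightarrow> functor_eq Q v z"
    using QQ Q(2) unfolding universal_for_def by blast
  from this[OF ab] this[OF id]
  have "omap b (omap a x) = x" if "x \<in> Obj Q" for x
    using that unfolding functor_eq_def comp_map_def id_map_def by simp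
  moreover from \<open>functor_eq Q (comp_map a b) z\<close> \<open>functor_eq Q id_map z\<close>
  have "mmap b (mmap a m) = m" if "m \<in> Arr Q" for m
    using that unfolding functor_eq_def comp_map_def id_map_def by simp
  ultimately have "inj_on (omap a) (Obj Q)" "inj_on (mmap a) (Arr Q)"
    by (auto intro: inj_on_inverseI)
  with a show ?thesis by blast
qed

lemma poset_category_reflect:
  assumes Q: "is_category Q" and a: "is_functor Q T a"
    and inj: "inj_on (omap a) (Obj Q)" "inj_on (mmap a) (Arr Q)"
    and T: "poset_category T"
  shows "poset_category Q"
proof -
  have ao: "omap a x \<in> Obj T" if "x \<in> Obj Q" for x
    using a that unfolding is_functor_def by blast
  have ah: "mmap a m \<in> Hom T (omap a x) (omap a y)" if "m \<in> Hom Q x y" for m x y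
    using a that unfolding is_functor_def Hom_def by auto
  show ?thesis
    unfolding poset_category_def
  proof (intro conjI ballI impI)
    fix x y m n
    assume xy: "x \<in> Obj Q" "y \<in> Obj Q" and mn: "m \<in> Hom Q x y" "n \<in> Hom Q x y"
    have "mmap a m = mmap a n"
      using T ao[OF xy(1)] ao[OF xy(2)] ah[OF mn(1)] ah[OF mn(2)]
      unfolding poset_category_def by blast
    thus "m = n" using inj(2) mn by (auto simp: Hom_def dest: inj_onD)
  next
    fix x y assume xy: "x \<in> Obj Q" "y \<in> Obj Q" "x \<noteq> y"
    hence "omap a x \<noteq> omap a y" using inj(1) by (auto dest: inj_onD)
    hence "Hom T (omap a x) (omap a y) = {} \<or> Hom T (omap a y) (omap a x) = {}"
      using T ao[OF xy(1)] ao[OF xy(2)] unfolding poset_category_def by blast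
    thus "Hom Q x y = {} \<or> Hom Q y x = {}" using ah by blast
  qed
qed


section \<open>The orbit category of a regular action\<close>

text \<open>
  Objects and morphisms are the orbits of objects and of morphisms. All structure maps are formed
  elementwise; in particular the composite of two orbits is the set of all composites of their
  members, which is a single orbit when the action is regular.
\<close>

definition orbit_category ::
  "('g, 'z) monoid_scheme \<Rightarrow> ('o, 'm) category \<Rightarrow> ('g \<Rightarrow> ('o, 'm, 'o, 'm) cat_map) \<Rightarrow>
   ('o set, 'm set) category" where
  "orbit_category G K A =
     \<lparr>Obj = obj_orbit G A ` Obj K,
      Arr = arr_orbit G A ` Arr K,
      Dom = (\<lambda>c. Dom K ` c),
      Cod = (\<lambda>c. Cod K ` c),
      Idt = (\<lambda>b. Idt K ` b),
      Cmp = (\<lambda>c d. {m \<cdot>\<^bsub>K\<^esub> n | m n. m \<in> c \<and> n \<in> d \<and> Cod K m = Dom K n})\<rparr>"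

text \<open>The functor from \<open>K\<close> to the orbit category which sends everything to its orbit.\<close>

definition orbit_proj ::
  "('g, 'z) monoid_scheme \<Rightarrow> ('g \<Rightarrow> ('o, 'm, 'o, 'm) cat_map) \<Rightarrow>
   ('o, 'm, 'o set, 'm set) cat_map" where
  "orbit_proj G A = \<lparr>omap = obj_orbit G A, mmap = arr_orbit G A\<rparr>"

context
  fixes G :: "('g, 'z) monoid_scheme" and K :: "('o, 'm) category"
    and A :: "'g \<Rightarrow> ('o, 'm, 'o, 'm) cat_map"
  assumes G: "group G" and K: "is_category K" and act: "category_action G K A"
begin

interpretation group G by (rule G)

private abbreviation "oo \<equiv> obj_orbit G A"
private abbreviation "ao \<equiv> arr_orbit G A"
private abbreviation "T \<equiv> orbit_category G K A"

private lemmas as = action_simps[OF G K act]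
private lemmas cs = cat_simps[OF G K act]

lemma arr_action_one: "m \<in> Arr K \<Longrightarrow> mmap (A \<one>\<^bsub>G\<^esub>) m = m"
  using act unfolding category_action_def functor_eq_def id_map_def by auto

lemma arr_action_mult:
  "g \<in> carrier G \<Longrightarrow> h \<in> carrier G \<Longrightarrow> m \<in> Arr K \<Longrightarrow>
   mmap (A (g \<otimes>\<^bsub>G\<^esub> h)) m = mmap (A g) (mmap (A h) m)"
  using act unfolding category_action_def functor_eq_def comp_map_def by auto

lemma action_cmp:
  "g \<in> carrier G \<Longrightarrow> m \<in> Arr K \<Longrightarrow> n \<in> Arr K \<Longrightarrow> Cod K m = Dom K n \<Longrightarrow>
   mmap (A g) (m \<cdot>\<^bsub>K\<^esub> n) = mmap (A g) m \<cdot>\<^bsub>K\<^esub> mmap (A g) n"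
  using act unfolding category_action_def is_functor_def by auto

lemma arr_orbit_self: "m \<in> Arr K \<Longrightarrow> m \<in> ao m"
  unfolding orbit_def using arr_action_one by (auto intro!: exI[of _ "\<one>\<^bsub>G\<^esub>"])

lemma arr_orbit_shift:
  assumes g: "g \<in> carrier G" and m: "m \<in> Arr K"
  shows "ao (mmap (A g) m) = ao m"
proof -
  have "\<exists>k\<in>carrier G. mmap (A h) (mmap (A g) m) = mmap (A k) m" if "h \<in> carrier G" for h
    using that g m arr_action_mult[of h g m] by (intro bexI[of _ "h \<otimes>\<^bsub>G\<^esub> g"]) auto
  moreover have "\<exists>k\<in>carrier G. mmap (A h) m = mmap (A k) (mmap (A g) m)"
    if "h \<in> carrier G" for h
    using that g m arr_action_mult[of "h \<otimes>\<^bsub>G\<^esub> inv\<^bsub>G\<^esub> g" g m]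
    by (intro bexI[of _ "h \<otimes>\<^bsub>G\<^esub> inv\<^bsub>G\<^esub> g"]) (auto simp: m_assoc)
  ultimately show ?thesis unfolding orbit_def by fastforce
qed

lemma arr_orbit_memD:
  assumes "n \<in> ao m" "m \<in> Arr K"
  shows "n \<in> Arr K" "ao n = ao m" "\<exists>g\<in>carrier G. n = mmap (A g) m"
proof -
  obtain g where g: "g \<in> carrier G" "n = mmap (A g) m"
    using assms unfolding orbit_def by auto
  show "n \<in> Arr K" "ao n = ao m" "\<exists>g\<in>carrier G. n = mmap (A g) m"
    using g assms(2) arr_orbit_shift as(2) by auto
qed

lemma arr_orbit_eqD:
  assumes "ao m = ao n" "m \<in> Arr K" "n \<in> Arr K"
  shows "\<exists>g\<in>carrier G. n = mmap (A g) m"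
  using assms arr_orbit_memD(3)[of n m] arr_orbit_self[of n] by auto

lemma arr_orbit_Dom: "m \<in> Arr K \<Longrightarrow> Dom K ` ao m = oo (Dom K m)"
  unfolding orbit_def using as(3) by (force simp: image_iff)

lemma arr_orbit_Cod: "m \<in> Arr K \<Longrightarrow> Cod K ` ao m = oo (Cod K m)"
  unfolding orbit_def using as(4) by (force simp: image_iff)

lemma obj_orbit_Idt: "x \<in> Obj K \<Longrightarrow> Idt K ` oo x = ao (Idt K x)"
  unfolding orbit_def using as(5) by (force simp: image_iff)

text \<open>An orbit of morphisms can be represented with any source in the orbit of its sources.\<close>

lemma arr_orbit_rep_Dom:
  assumes "x \<in> Obj K" "n \<in> Arr K" "oo x = oo (Dom K n)"
  obtains n' where "n' \<in> Arr K" "ao n' = ao n" "Dom K n' = x"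
proof -
  obtain g where g: "g \<in> carrier G" "x = omap (A g) (Dom K n)"
    using orbit_eqD[OF G K act, of "Dom K n" x] assms cs by auto
  show thesis
    using that[of "mmap (A g) n"] g assms(2) as arr_orbit_shift by simp
qed

lemma orbit_category_simps:
  "Obj T = oo ` Obj K" "Arr T = ao ` Arr K"
  "m \<in> Arr K \<Longrightarrow> Dom T (ao m) = oo (Dom K m)"
  "m \<in> Arr K \<Longrightarrow> Cod T (ao m) = oo (Cod K m)"
  "x \<in> Obj K \<Longrightarrow> Idt T (oo x) = ao (Idt K x)"
  by (simp_all add: orbit_category_def arr_orbit_Dom arr_orbit_Cod obj_orbit_Idt)

lemma orbit_category_Cmp:
  assumes R: "acts_regularly G K A"
    and mn: "m \<in> Arr K" "n \<in> Arr K" "Cod K m = Dom K n"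
  shows "ao m \<cdot>\<^bsub>T\<^esub> ao n = ao (m \<cdot>\<^bsub>K\<^esub> n)"
proof -
  have "m' \<cdot>\<^bsub>K\<^esub> n' \<in> ao (m \<cdot>\<^bsub>K\<^esub> n)"
    if h: "m' \<in> ao m" "n' \<in> ao n" "Cod K m' = Dom K n'" for m' n'
  proof -
    note m' = arr_orbit_memD[OF h(1) mn(1)] and n' = arr_orbit_memD[OF h(2) mn(2)]
    \<comment> \<open>Translate the pair \<open>m', n'\<close> so that its first member becomes \<open>m\<close>.\<close>
    obtain g where g: "g \<in> carrier G" "m = mmap (A g) m'"
      using arr_orbit_eqD[OF m'(2) m'(1) mn(1)] by blast
    have "ao n = ao (mmap (A g) n')" using n' g arr_orbit_shift by simp
    moreover have "Cod K m = Dom K (mmap (A g) n')" using g m' n' h(3) as by simp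
    ultimately have "ao (m \<cdot>\<^bsub>K\<^esub> n) = ao (m \<cdot>\<^bsub>K\<^esub> mmap (A g) n')"
      using R mn as(2)[OF g(1) n'(1)] unfolding acts_regularly_def by blast
    also have "\<dots> = ao (m' \<cdot>\<^bsub>K\<^esub> n')"
      using g action_cmp[OF g(1) m'(1) n'(1) h(3)] arr_orbit_shift[OF g(1)] cs(6) m' n' h(3)
      by metis
    finally show ?thesis using arr_orbit_self[OF cs(6)[OF m'(1) n'(1) h(3)]] by simp
  qed
  moreover have "\<exists>m' n'. l = m' \<cdot>\<^bsub>K\<^esub> n' \<and> m' \<in> ao m \<and> n' \<in> ao n \<and> Cod K m' = Dom K n'"
    if l: "l \<in> ao (m \<cdot>\<^bsub>K\<^esub> n)" for l
  proof -
    obtain g where g: "g \<in> carrier G" "l = mmap (A g) m \<cdot>\<^bsub>K\<^esub> mmap (A g) n"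
      using arr_orbit_memD(3)[OF l cs(6)[OF mn]] action_cmp mn by auto
    moreover have "mmap (A g) m \<in> ao m" "mmap (A g) n \<in> ao n"
      using g(1) unfolding orbit_def by auto
    ultimately show ?thesis using as mn by metis
  qed
  ultimately show ?thesis unfolding orbit_category_def by auto
qed

text \<open>Orbits which can be composed in the orbit category have composable representatives.\<close>

lemma orbit_category_composable:
  assumes "m \<in> Arr K" "d \<in> Arr T" "Cod T (ao m) = Dom T d"
  obtains n where "n \<in> Arr K" "d = ao n" "Cod K m = Dom K n"
proof -
  obtain n where n: "n \<in> Arr K" "d = ao n" using assms(2) by (auto simp: orbit_category_simps)
  hence "oo (Cod K m) = oo (Dom K n)" using assms by (simp add: orbit_category_simps)
  from arr_orbit_rep_Dom[OF cs(2)[OF assms(1)] n(1) this] that n(2) show thesis by metis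
qed

lemma orbit_category_category:
  assumes R: "acts_regularly G K A"
  shows "is_category T"
  unfolding is_category_def
proof (intro conjI ballI impI)
  note cmp = orbit_category_Cmp[OF R] and s = orbit_category_simps
  fix c assume "c \<in> Arr T"
  then obtain m where m: "m \<in> Arr K" "c = ao m" by (auto simp: s)
  show "Dom T c \<in> Obj T" "Cod T c \<in> Obj T" using m cs by (auto simp: s)
  show "Idt T (Dom T c) \<cdot>\<^bsub>T\<^esub> c = c" "c \<cdot>\<^bsub>T\<^esub> Idt T (Cod T c) = c"
    using m by (simp_all add: s cs cmp)
  fix d assume d: "d \<in> Arr T"
  {
    assume "Cod T c = Dom T d"
    then obtain n where n: "n \<in> Arr K" "d = ao n" "Cod K m = Dom K n"
      using orbit_category_composable[OF m(1) d] m(2) by metis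
    show "c \<cdot>\<^bsub>T\<^esub> d \<in> Arr T" "Dom T (c \<cdot>\<^bsub>T\<^esub> d) = Dom T c" "Cod T (c \<cdot>\<^bsub>T\<^esub> d) = Cod T d"
      using m n by (simp_all add: s cs cmp)
  }
  fix e assume e: "e \<in> Arr T" and "Cod T c = Dom T d" "Cod T d = Dom T e"
  then obtain n where n: "n \<in> Arr K" "d = ao n" "Cod K m = Dom K n"
    using orbit_category_composable[OF m(1) d] m(2) by metis
  then obtain l where l: "l \<in> Arr K" "e = ao l" "Cod K n = Dom K l"
    using orbit_category_composable[OF n(1) e] \<open>Cod T d = Dom T e\<close> by metis
  have "m \<cdot>\<^bsub>K\<^esub> n \<cdot>\<^bsub>K\<^esub> l = m \<cdot>\<^bsub>K\<^esub> (n \<cdot>\<^bsub>K\<^esub> l)"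
    using K m n l unfolding is_category_def by blast
  thus "c \<cdot>\<^bsub>T\<^esub> d \<cdot>\<^bsub>T\<^esub> e = c \<cdot>\<^bsub>T\<^esub> (d \<cdot>\<^bsub>T\<^esub> e)" using m n l by (simp add: cs cmp)
next
  fix b assume "b \<in> Obj T"
  then obtain x where x: "x \<in> Obj K" "b = oo x" by (auto simp: orbit_category_simps)
  thus "Idt T b \<in> Arr T" "Dom T (Idt T b) = b" "Cod T (Idt T b) = b"
    by (simp_all add: orbit_category_simps cs)
qed

lemma orbit_proj_cocone:
  assumes R: "acts_regularly G K A"
  shows "is_cocone G K A T (orbit_proj G A)"
  unfolding is_cocone_def is_functor_def functor_eq_def
  by (auto simp: orbit_proj_def comp_map_def orbit_category_simps orbit_category_Cmp[OF R] cs
      orbit_shift[OF G K act] arr_orbit_shift)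

lemma orbit_category_universal:
  fixes X :: "('p, 'n) category"
  assumes R: "acts_regularly G K A"
  shows "universal_for G K A T (orbit_proj G A) X"
  unfolding universal_for_def
proof (intro allI impI)
  fix f assume f: "is_cocone G K A X f"
  have F: "is_functor K X f" using f unfolding is_cocone_def by blast
  have inv: "g \<in> carrier G \<Longrightarrow> x \<in> Obj K \<Longrightarrow> omap f (omap (A g) x) = omap f x"
    "g \<in> carrier G \<Longrightarrow> m \<in> Arr K \<Longrightarrow> mmap f (mmap (A g) m) = mmap f m" for g x m
    using f unfolding is_cocone_def functor_eq_def comp_map_def by auto
  define u where
    "u = \<lparr>omap = (\<lambda>b. omap f (SOME x. x \<in> b)), mmap = (\<lambda>c. mmap f (SOME m. m \<in> c))\<rparr>"
  have uo: "omap u (oo x) = omap f x" if "x \<in> Obj K" for x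
    using orbit_rep(3)[OF G K act that] inv(1) that by (auto simp: u_def)
  have um: "mmap u (ao m) = mmap f m" if "m \<in> Arr K" for m
  proof -
    have "(SOME n. n \<in> ao m) \<in> ao m" using arr_orbit_self[OF that] by (rule someI)
    from arr_orbit_memD(3)[OF this that] show ?thesis using inv(2) that by (auto simp: u_def)
  qed
  have uf: "is_functor T X u"
    unfolding is_functor_def
  proof (intro conjI ballI impI)
    fix c assume "c \<in> Arr T"
    then obtain m where m: "m \<in> Arr K" "c = ao m" by (auto simp: orbit_category_simps)
    show "mmap u c \<in> Arr X" "Dom X (mmap u c) = omap u (Dom T c)"
      "Cod X (mmap u c) = omap u (Cod T c)"
      using F m by (auto simp: is_functor_def orbit_category_simps uo um cs)
    fix d assume d: "d \<in> Arr T" "Cod T c = Dom T d"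
    obtain n where n: "n \<in> Arr K" "d = ao n" "Cod K m = Dom K n"
      using orbit_category_composable[OF m(1) d(1)] d(2) m(2) by metis
    show "mmap u (c \<cdot>\<^bsub>T\<^esub> d) = mmap u c \<cdot>\<^bsub>X\<^esub> mmap u d"
      using F m n by (simp add: is_functor_def orbit_category_Cmp[OF R] um cs)
  next
    fix b assume "b \<in> Obj T"
    then obtain x where x: "x \<in> Obj K" "b = oo x" by (auto simp: orbit_category_simps)
    thus "omap u b \<in> Obj X" "mmap u (Idt T b) = Idt X (omap u b)"
      using F by (auto simp: is_functor_def orbit_category_simps uo um cs)
  qed
  have ue: "functor_eq K (comp_map (orbit_proj G A) u) f"
    unfolding functor_eq_def by (auto simp: comp_map_def orbit_proj_def uo um)
  have "functor_eq T v u" if "functor_eq K (comp_map (orbit_proj G A) v) f" for v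
    using that unfolding functor_eq_def
    by (auto simp: comp_map_def orbit_proj_def orbit_category_simps uo um)
  with uf ue show "\<exists>u. is_functor T X u \<and> functor_eq K (comp_map (orbit_proj G A) u) f \<and>
      (\<forall>v. is_functor T X v \<and> functor_eq K (comp_map (orbit_proj G A) v) f \<longrightarrow> functor_eq T v u)"
    by blast
qed

lemma quotient_embeds_orbit_category:
  assumes R: "acts_regularly G K A" and Q: "is_quotient G K A Q p"
  shows "\<exists>a. is_functor Q T a \<and> functor_eq K (comp_map p a) (orbit_proj G A) \<and>
    inj_on (omap a) (Obj Q) \<and> inj_on (mmap a) (Arr Q)"
proof (rule colimit_comparison)
  show "is_category Q" "is_cocone G K A Q p" using Q unfolding is_quotient_def by auto
  show "universal_for G K A Q p Q"
    by (rule quotient_universal[OF G K act Q \<open>is_category Q\<close>])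
  show "universal_for G K A Q p T"
    by (rule quotient_universal[OF G K act Q orbit_category_category[OF R]])
qed (rule orbit_proj_cocone[OF R] orbit_category_universal[OF R])+


section \<open>Condition (SR)\<close>

lemma SR_imp_regular:
  assumes SR: "condition_SR G K A"
  shows "acts_regularly G K A"
  unfolding acts_regularly_def
proof (intro ballI impI, elim conjE)
  fix x ya yb
  assume h: "x \<in> Arr K" "ya \<in> Arr K" "yb \<in> Arr K" "Cod K x = Dom K ya" "Cod K x = Dom K yb"
    and "ao ya = ao yb"
  hence "oo (Cod K ya) = oo (Cod K yb)" using arr_orbit_Cod by metis
  thus "ao (x \<cdot>\<^bsub>K\<^esub> ya) = ao (x \<cdot>\<^bsub>K\<^esub> yb)"
    using SR h cs(6-8) unfolding condition_SR_def by metis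
qed

lemma SR_imp_orbit_category_poset:
  assumes SR: "condition_SR G K A" and lf: "loopfree K"
  shows "poset_category T"
  unfolding poset_category_def
proof (intro conjI ballI impI)
  fix b b' c d
  assume "c \<in> Hom T b b'" "d \<in> Hom T b b'"
  then obtain m n where m: "m \<in> Arr K" "c = ao m" and n: "n \<in> Arr K" "d = ao n"
    and e: "oo (Dom K m) = oo (Dom K n)" "oo (Cod K m) = oo (Cod K n)"
    by (auto simp: Hom_def orbit_category_simps)
  \<comment> \<open>(SR) needs equal sources, so \<open>n\<close> is translated to start where \<open>m\<close> does.\<close>
  obtain n' where n': "n' \<in> Arr K" "ao n' = ao n" "Dom K n' = Dom K m"
    using arr_orbit_rep_Dom[OF cs(1)[OF m(1)] n(1) e(1)] by metis
  have "oo (Cod K n') = oo (Cod K n)" using n n' arr_orbit_Cod by metis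
  hence "ao m = ao n'" using SR m n' e unfolding condition_SR_def by metis
  thus "c = d" using m n n' by simp
next
  fix b b' :: "'o set"
  assume ne: "b \<noteq> b'"
  show "Hom T b b' = {} \<or> Hom T b' b = {}"
  proof (rule ccontr)
    assume "\<not> ?thesis"
    then obtain c d where c: "c \<in> Hom T b b'" and d: "d \<in> Hom T b' b" by blast
    obtain m where m: "m \<in> Arr K" "c = ao m" "oo (Dom K m) = b" "oo (Cod K m) = b'"
      using c by (auto simp: Hom_def orbit_category_simps)
    obtain n where n: "n \<in> Arr K" "d = ao n" "Cod K m = Dom K n"
      using orbit_category_composable[of m d] m c d by (auto simp: Hom_def)
    have nb: "oo (Cod K n) = b" using d n by (simp add: Hom_def orbit_category_simps)
    let ?x = "Dom K m" and ?i = "Idt K (Dom K m)"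
    have x: "?x \<in> Obj K" using m cs by simp
    have mn: "m \<cdot>\<^bsub>K\<^esub> n \<in> Arr K" using m n cs by simp
    \<comment> \<open>Both morphisms start at \<open>?x\<close>, and their targets lie in the orbit \<open>b\<close>.\<close>
    have "ao ?i = ao (m \<cdot>\<^bsub>K\<^esub> n)"
      using SR m n nb x mn cs unfolding condition_SR_def by metis
    then obtain g where g: "g \<in> carrier G" "m \<cdot>\<^bsub>K\<^esub> n = mmap (A g) ?i"
      using arr_orbit_eqD mn cs(3)[OF x] by blast
    hence "m \<cdot>\<^bsub>K\<^esub> n = Idt K (omap (A g) ?x)" "omap (A g) ?x \<in> Obj K"
      using x as by auto
    hence "Dom K (m \<cdot>\<^bsub>K\<^esub> n) = Cod K (m \<cdot>\<^bsub>K\<^esub> n)" using cs(4,5) by simp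
    hence "Cod K n = ?x" using m n cs by simp
    hence "m \<in> Hom K ?x (Cod K m)" "n \<in> Hom K (Cod K m) ?x" using m n by (auto simp: Hom_def)
    hence "?x = Cod K m" using lf x cs(2)[OF m(1)] unfolding loopfree_def by blast
    thus False using m ne by simp
  qed
qed

end

theorem proposition3p13:
  fixes G :: "('g, 'z) monoid_scheme"
    and K :: "('o, 'm) category"
    and A :: "'g \<Rightarrow> ('o, 'm, 'o, 'm) cat_map"
    and K_mod_G :: "('q, 'l) category"
    and p :: "('o, 'm, 'q, 'l) cat_map"
  assumes "is_category K"
    and "loopfree K"
    and "group G"
    and "category_action G K A"
    and "is_quotient G K A K_mod_G p"
  shows "condition_SR G K A \<longleftrightarrow> acts_regularly G K A \<and> poset_category K_mod_G"
proof
  note gka = assms(3) assms(1) assms(4)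
  assume SR: "condition_SR G K A"
  have R: "acts_regularly G K A" by (rule SR_imp_regular[OF gka SR])
  have "is_category K_mod_G" using assms(5) unfolding is_quotient_def by blast
  moreover obtain a where "is_functor K_mod_G (orbit_category G K A) a"
    "inj_on (omap a) (Obj K_mod_G)" "inj_on (mmap a) (Arr K_mod_G)"
    using quotient_embeds_orbit_category[OF gka R assms(5)] by blast
  ultimately have "poset_category K_mod_G"
    using poset_category_reflect SR_imp_orbit_category_poset[OF gka SR assms(2)] by blast
  with R show "acts_regularly G K A \<and> poset_category K_mod_G" by blast
next
  note gka = assms(3) assms(1) assms(4)
  assume RP: "acts_regularly G K A \<and> poset_category K_mod_G"
  obtain a where a: "functor_eq K (comp_map p a) (orbit_proj G A)"
    using quotient_embeds_orbit_category[OF gka _ assms(5)] RP by blast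
  have p: "is_functor K K_mod_G p"
    and inv: "\<And>g. g \<in> carrier G \<Longrightarrow> functor_eq K (comp_map (A g) p) p"
    using assms(5) unfolding is_quotient_def is_cocone_def by auto
  show "condition_SR G K A"
    unfolding condition_SR_def
  proof (intro ballI impI, elim conjE)
    fix x y
    assume xy: "x \<in> Arr K" "y \<in> Arr K" and dom: "Dom K x = Dom K y"
      and cod: "obj_orbit G A (Cod K x) = obj_orbit G A (Cod K y)"
    have "Cod K x \<in> Obj K" "Cod K y \<in> Obj K" using xy cat_simps[OF gka] by auto
    moreover from this obtain g where "g \<in> carrier G" "Cod K y = omap (A g) (Cod K x)"
      using orbit_eqD[OF gka cod] by blast
    ultimately have "omap p (Cod K x) = omap p (Cod K y)"
      using inv[of g] unfolding functor_eq_def comp_map_def by auto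
    hence "mmap p x \<in> Hom K_mod_G (omap p (Dom K x)) (omap p (Cod K x))"
      "mmap p y \<in> Hom K_mod_G (omap p (Dom K x)) (omap p (Cod K x))"
      using p xy dom unfolding is_functor_def Hom_def by auto
    moreover have "omap p (Dom K x) \<in> Obj K_mod_G" "omap p (Cod K x) \<in> Obj K_mod_G"
      using p xy cat_simps[OF gka] unfolding is_functor_def by auto
    ultimately have "mmap p x = mmap p y" using RP unfolding poset_category_def by blast
    thus "arr_orbit G A x = arr_orbit G A y"
      using a xy unfolding functor_eq_def comp_map_def orbit_proj_def by (simp, metis)
  qed
qed

end
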